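(* For every finite graph $H$, there is a hereditary weakly sparse class $\mathcal C_H$ of finite graphs of unbounded treewidth such that the subclass $\{G \in \mathcal C_H : G \text{ is } H\text{-free}\}$ has bounded treewidth.
   Context: A graph $G$ is $H$-free if $H$ is not isomorphic to an induced subgraph of $G$. A class of graphs is hereditary if it is closed under taking induced subgraphs. A class is weakly sparse if there is a finite integer $t$ such that no graph of the class contains the complete bipartite graph $K_{t,t}$ as a (not necessarily induced) subgraph. A class has bounded (resp. unbounded) treewidth if the treewidths of its members are (resp. are not) bounded by a constant. *)

theory Defs
  imports Main
begin

type_synonym 'a graph = "'a set \<times> 'a set set"

definition verts :: "'a graph \<Rightarrow> 'a set" where "verts G = fst G"
definition edges :: "'a graph \<Rightarrow> 'a set set" where "edges G = snd G"

definition finite_graph :: "'a graph \<Rightarrow> bool" where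
  "finite_graph G \<longleftrightarrow> finite (verts G) \<and>
     (\<forall>e\<in>edges G. \<exists>u v. e = {u, v} \<and> u \<noteq> v \<and> u \<in> verts G \<and> v \<in> verts G)"

definition adj :: "'a graph \<Rightarrow> 'a \<Rightarrow> 'a \<Rightarrow> bool" where
  "adj G u v \<longleftrightarrow> u \<noteq> v \<and> {u, v} \<in> edges G"

definition induced_subgraph :: "'a graph \<Rightarrow> 'a set \<Rightarrow> 'a graph" where
  "induced_subgraph G S = (S, {e \<in> edges G. e \<subseteq> S})"

definition contains_induced :: "'b graph \<Rightarrow> 'a graph \<Rightarrow> bool" where
  "contains_induced H G \<longleftrightarrow> (\<exists>f. inj_on f (verts H) \<and> f ` verts H \<subseteq> verts G \<and>
     (\<forall>u\<in>verts H. \<forall>v\<in>verts H. adj H u v \<longleftrightarrow> adj G (f u) (f v)))"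

definition H_free :: "'b graph \<Rightarrow> 'a graph \<Rightarrow> bool" where
  "H_free H G \<longleftrightarrow> \<not> contains_induced H G"

definition hereditary :: "'a graph set \<Rightarrow> bool" where
  "hereditary C \<longleftrightarrow> (\<forall>G\<in>C. \<forall>S. S \<subseteq> verts G \<longrightarrow> induced_subgraph G S \<in> C)"

definition contains_Ktt :: "'a graph \<Rightarrow> nat \<Rightarrow> bool" where
  "contains_Ktt G t \<longleftrightarrow> (\<exists>A B. A \<subseteq> verts G \<and> B \<subseteq> verts G \<and> A \<inter> B = {} \<and>
      card A = t \<and> card B = t \<and> finite A \<and> finite B \<and> (\<forall>a\<in>A. \<forall>b\<in>B. adj G a b))"

definition weakly_sparse :: "'a graph set \<Rightarrow> bool" where
  "weakly_sparse C \<longleftrightarrow> (\<exists>t::nat. \<forall>G\<in>C. \<not> contains_Ktt G t)"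

definition connected_in :: "'a graph \<Rightarrow> 'a set \<Rightarrow> bool" where
  "connected_in G X \<longleftrightarrow>
     (\<forall>u\<in>X. \<forall>v\<in>X. (\<lambda>x y. x \<in> X \<and> y \<in> X \<and> adj G x y)\<^sup>*\<^sup>* u v)"

definition has_cycle :: "'a graph \<Rightarrow> bool" where
  "has_cycle G \<longleftrightarrow> (\<exists>xs. length xs \<ge> 3 \<and> distinct xs \<and> set xs \<subseteq> verts G \<and>
     (\<forall>i<length xs. adj G (xs ! i) (xs ! ((i + 1) mod length xs))))"

definition is_tree :: "'t graph \<Rightarrow> bool" where
  "is_tree T \<longleftrightarrow> finite_graph T \<and> verts T \<noteq> {} \<and> connected_in T (verts T) \<and> \<not> has_cycle T"

definition tree_decomposition :: "'a graph \<Rightarrow> nat graph \<Rightarrow> (nat \<Rightarrow> 'a set) \<Rightarrow> bool" where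
  "tree_decomposition G T B \<longleftrightarrow> is_tree T \<and>
     (\<forall>t\<in>verts T. B t \<subseteq> verts G) \<and>
     (\<forall>v\<in>verts G. \<exists>t\<in>verts T. v \<in> B t) \<and>
     (\<forall>u v. adj G u v \<longrightarrow> (\<exists>t\<in>verts T. u \<in> B t \<and> v \<in> B t)) \<and>
     (\<forall>v\<in>verts G. connected_in T {t \<in> verts T. v \<in> B t})"

definition treewidth_le :: "'a graph \<Rightarrow> nat \<Rightarrow> bool" where
  "treewidth_le G k \<longleftrightarrow> (\<exists>T B. tree_decomposition G T B \<and> (\<forall>t\<in>verts T. card (B t) \<le> k + 1))"

definition bounded_treewidth :: "'a graph set \<Rightarrow> bool" where
  "bounded_treewidth C \<longleftrightarrow> (\<exists>k. \<forall>G\<in>C. treewidth_le G k)"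

end

theory Submission
  imports Defs "HOL-Library.Nat_Bijection"
begin

text \<open>
  Fix \<open>h \<ge> \<bar>V(H)\<bar>\<close>. Take an infinite forest in which every node carries a memory of \<open>h\<close> slots, each
  holding an ancestor or nothing, and has one child for every pair \<open>(s, A)\<close>: the child is joined to the
  nodes in the slots of \<open>A\<close> and then stores itself in slot \<open>s\<close>. Moreover, each layer is a path. The class
  consists of the finite induced subgraphs of this graph. Vertices have at most \<open>h + 2\<close> neighbours that
  are not deeper than themselves, which gives weak sparsity; the layers are the branch sets of large
  clique minors, which gives unbounded treewidth.

  Suppose that the vertices kept in \<open>X\<close> induce no copy of \<open>H\<close>. From any node walk downwards, always to the
  child that, were it in \<open>X\<close>, would extend the longest prefix of \<open>H\<close> embedded in the slots
  \<open>0, 1, \<dots>\<close>. Each visit to \<open>X\<close> lengthens that prefix and no step destroys it, so the walk meets \<open>X\<close>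
  fewer than \<open>h\<close> times after its start. Together with the memory of its start, it separates what lies on
  its left below the start from what lies on its right. These separators of size \<open>O(h)\<close> are nested
  like the forest and yield a tree decomposition of width \<open>O(h)\<close>.
\<close>

section \<open>Trees and tree decompositions\<close>

lemma adj_sym: "adj G u v \<longleftrightarrow> adj G v u"
  by (auto simp: adj_def insert_commute)

lemma reach_sym:
  assumes "(\<lambda>x y. x \<in> X \<and> y \<in> X \<and> adj G x y)\<^sup>*\<^sup>* u v"
  shows "(\<lambda>x y. x \<in> X \<and> y \<in> X \<and> adj G x y)\<^sup>*\<^sup>* v u"
  using assms
proof induction
  case (step y z)
  then show ?case
    by (metis (mono_tags, lifting) adj_sym converse_rtranclp_into_rtranclp)
qed simp

lemma connected_in_star:
  assumes "\<And>u. u \<in> X \<Longrightarrow> (\<lambda>x y. x \<in> X \<and> y \<in> X \<and> adj G x y)\<^sup>*\<^sup>* u c"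
  shows "connected_in G X"
  unfolding connected_in_def
proof (intro ballI)
  fix u v assume "u \<in> X" "v \<in> X"
  then show "(\<lambda>x y. x \<in> X \<and> y \<in> X \<and> adj G x y)\<^sup>*\<^sup>* u v"
    by (rule rtranclp_trans[OF assms reach_sym[OF assms]])
qed

section \<open>Trees presented by parent maps\<close>

locale rooted =
  fixes N :: "nat set" and r :: nat and p :: "nat \<Rightarrow> nat" and rank :: "nat \<Rightarrow> nat"
  assumes finite_N: "finite N" and root: "r \<in> N"
    and parent: "t \<in> N \<Longrightarrow> t \<noteq> r \<Longrightarrow> p t \<in> N"
    and rank: "t \<in> N \<Longrightarrow> t \<noteq> r \<Longrightarrow> rank (p t) < rank t"
begin

definition tree :: "nat graph" where "tree = (N, {{t, p t} | t. t \<in> N \<and> t \<noteq> r})"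

lemma adj_tree:
  "adj tree u v \<longleftrightarrow> (u \<in> N \<and> u \<noteq> r \<and> v = p u) \<or> (v \<in> N \<and> v \<noteq> r \<and> u = p v)"
proof -
  have ne: "t \<in> N \<Longrightarrow> t \<noteq> r \<Longrightarrow> t \<noteq> p t" for t using rank by fastforce
  then show ?thesis
    unfolding adj_def tree_def edges_def by (auto simp: doubleton_eq_iff dest: ne ne[symmetric])
qed

text \<open>Following parents from any element stays inside \<open>X\<close> and has to stop because
  \<open>rank\<close> decreases; it can stop only at \<open>c\<close>.\<close>

lemma connected_in_upclosed:
  assumes "X \<subseteq> N" and top: "\<And>t. t \<in> X \<Longrightarrow> t = c \<or> (t \<noteq> r \<and> p t \<in> X)"
  shows "connected_in tree X"
proof (rule connected_in_star)
  fix u assume "u \<in> X"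
  then show "(\<lambda>x y. x \<in> X \<and> y \<in> X \<and> adj tree x y)\<^sup>*\<^sup>* u c"
  proof (induction "rank u" arbitrary: u rule: less_induct)
    case less
    show ?case
    proof (cases "u = c")
      case False
      then have *: "u \<noteq> r" "p u \<in> X" "u \<in> N" using top less assms(1) by auto
      then have "adj tree u (p u)" by (auto simp: adj_tree)
      then show ?thesis using less * rank[of u]
        by (intro converse_rtranclp_into_rtranclp[of _ u "p u"]) auto
    qed simp
  qed
qed

lemma is_tree: "is_tree tree"
proof -
  have "\<not> has_cycle tree"
  proof
    assume "has_cycle tree"
    then obtain xs where L: "length xs \<ge> 3" and d: "distinct xs"
      and a: "\<And>i. i < length xs \<Longrightarrow> adj tree (xs ! i) (xs ! ((i + 1) mod length xs))"
      unfolding has_cycle_def by blast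
    let ?L = "length xs"
    \<comment> \<open>At a vertex of maximal rank on the cycle, both the successor (index
      \<open>j\<close>) and the predecessor (index \<open>k\<close>) must be its parent. On a cycle
      of length at least 3 they are distinct.\<close>
    let ?r = "(\<lambda>j. rank (xs ! j)) ` {..<?L}"
    have "Max ?r \<in> ?r" using L by (intro Max_in) (auto simp: lessThan_empty_iff)
    then obtain i where i: "i < ?L" and "rank (xs ! i) = Max ?r" by auto
    then have mx: "rank (xs ! j) \<le> rank (xs ! i)" if "j < ?L" for j using that by simp
    have up: "xs ! j = p (xs ! i)" if "j < ?L" "adj tree (xs ! i) (xs ! j)" for j
      using that mx[OF that(1)] rank[of "xs ! j"] by (auto simp: adj_tree)
    define j where "j = (i + 1) mod ?L"
    define k where "k = (if i = 0 then ?L - 1 else i - 1)"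
    have jk: "j < ?L" "k < ?L" "(k + 1) mod ?L = i"
      using L i by (auto simp: j_def k_def intro!: mod_less_divisor)
    have "xs ! j = p (xs ! i)" using up jk a[OF i] j_def by blast
    moreover have "xs ! k = p (xs ! i)" using up jk a[of k] adj_sym by metis
    ultimately have "j = k" using d jk by (metis nth_eq_iff_index_eq)
    moreover have "j = (if i + 1 = ?L then 0 else i + 1)" using i by (auto simp: j_def)
    ultimately show False using L i by (auto simp: k_def split: if_splits)
  qed
  moreover have "connected_in tree N"
    by (rule connected_in_upclosed[where c = r]) (use parent in auto)
  moreover have "finite_graph tree"
    unfolding finite_graph_def
    using finite_N parent rank by (force simp: tree_def verts_def edges_def)
  ultimately show ?thesis using root unfolding is_tree_def by (auto simp: tree_def verts_def)
qed

text \<open>The last premise is a local form of connectivity: the nodes whose bag contains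
  \<open>v\<close> are closed under parents, with at most one exception \<open>c\<close>.\<close>

lemma treewidth_le:
  assumes "\<And>t. t \<in> N \<Longrightarrow> B t \<subseteq> verts G" "\<And>t. t \<in> N \<Longrightarrow> card (B t) \<le> k + 1"
    and "\<And>v. v \<in> verts G \<Longrightarrow> \<exists>t\<in>N. v \<in> B t"
    and "\<And>u v. adj G u v \<Longrightarrow> \<exists>t\<in>N. u \<in> B t \<and> v \<in> B t"
    and "\<And>v. v \<in> verts G \<Longrightarrow> \<exists>c. \<forall>t\<in>N. v \<in> B t \<longrightarrow> t = c \<or> (t \<noteq> r \<and> v \<in> B (p t))"
  shows "treewidth_le G k"
proof -
  have [simp]: "verts tree = N" by (simp add: tree_def verts_def)
  have "connected_in tree {t \<in> N. v \<in> B t}" if v: "v \<in> verts G" for v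
  proof -
    obtain c where "\<forall>t\<in>N. v \<in> B t \<longrightarrow> t = c \<or> (t \<noteq> r \<and> v \<in> B (p t))" using assms(5)[OF v] ..
    then show ?thesis by (intro connected_in_upclosed[where c = c]) (use parent in auto)
  qed
  then have "tree_decomposition G tree B"
    unfolding tree_decomposition_def using assms is_tree by simp
  then show ?thesis unfolding treewidth_le_def
    using assms(2) by (intro exI[of _ tree] exI[of _ B]) simp
qed

end

section \<open>Leaves, the Helly property of subtrees, and minors\<close>

lemma acyclic_has_leaf:
  assumes fin: "finite V" and ne: "V \<noteq> {}" and sub: "V \<subseteq> verts G" and nc: "\<not> has_cycle G"
  shows "\<exists>x\<in>V. \<exists>y. \<forall>z\<in>V. adj G x z \<longrightarrow> z = y"
proof (rule ccontr)
  assume no: "\<not> ?thesis"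
  then have deg: "\<exists>z\<in>V. adj G x z \<and> z \<noteq> y" if "x \<in> V" for x y
    using that no by blast
  define P where "P xs \<longleftrightarrow> xs \<noteq> [] \<and> distinct xs \<and> set xs \<subseteq> V \<and>
    (\<forall>i. Suc i < length xs \<longrightarrow> adj G (xs ! i) (xs ! Suc i))" for xs
  obtain v where "v \<in> V" using ne by blast
  then have "P [v]" by (simp add: P_def)
  moreover have bnd: "\<forall>xs. P xs \<longrightarrow> length xs \<le> card V"
    by (metis P_def card_mono distinct_card fin)
  ultimately obtain xs where xs: "P xs" and mx: "\<And>ys. P ys \<Longrightarrow> length ys \<le> length xs"
    using ex_has_greatest_nat[of P "[v]" length "Suc (card V)"] by (metis le_imp_less_Suc)
  define x where "x = xs ! 0"
  have x: "x \<in> V" using xs by (auto simp: P_def x_def)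
  \<comment> \<open>\<open>x\<close> starts a longest path, so its neighbour \<open>z\<close> lies
    on that path and, not being the second vertex, closes a cycle. For a one-vertex path
    \<open>xs ! 1\<close> is unspecified but harmless: \<open>z\<close> could then only be
    \<open>x\<close> itself.\<close>
  obtain z where z: "z \<in> V" "adj G x z" "z \<noteq> xs ! 1" using deg[OF x] by metis
  have "z \<in> set xs"
  proof (rule ccontr)
    assume n: "z \<notin> set xs"
    have "P (z # xs)" unfolding P_def
    proof (intro conjI allI impI)
      fix i assume "Suc i < length (z # xs)"
      then show "adj G ((z # xs) ! i) ((z # xs) ! Suc i)"
        using xs z(2) adj_sym[of G] by (cases i) (auto simp: P_def x_def)
    qed (use n z xs in \<open>auto simp: P_def\<close>)
    from mx[OF this] show False by simp
  qed
  then obtain j where j: "j < length xs" "z = xs ! j" by (metis in_set_conv_nth)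
  have "j \<noteq> 0" using z(2) j by (metis adj_def x_def)
  moreover have "j \<noteq> 1" using z(3) j by auto
  ultimately have j2: "j \<ge> 2" by simp
  have "has_cycle G" unfolding has_cycle_def
  proof (intro exI conjI allI impI)
    show "3 \<le> length (take (j + 1) xs)" using j j2 by simp
    show "distinct (take (j + 1) xs)" using xs by (simp add: P_def)
    show "set (take (j + 1) xs) \<subseteq> verts G" using xs sub set_take_subset[of "j + 1" xs] by (auto simp: P_def)
    fix i assume i: "i < length (take (j + 1) xs)"
    have l: "length (take (j + 1) xs) = j + 1" using j by simp
    show "adj G (take (j + 1) xs ! i) (take (j + 1) xs ! ((i + 1) mod length (take (j + 1) xs)))"
    proof (cases "i = j")
      case True
      then show ?thesis using l j z(2) adj_sym[of G] by (simp add: x_def)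
    next
      case False
      then have "i < j" using i l by simp
      then show ?thesis using l j xs by (simp add: P_def)
    qed
  qed
  with nc show False ..
qed

lemma connected_in_remove_leaf:
  assumes con: "connected_in G X" and leaf: "\<And>z. z \<in> X \<Longrightarrow> adj G x z \<Longrightarrow> z = y"
  shows "connected_in G (X - {x})"
  unfolding connected_in_def
proof (intro ballI)
  let ?R = "\<lambda>a b. a \<in> X - {x} \<and> b \<in> X - {x} \<and> adj G a b"
  fix u v assume uv: "u \<in> X - {x}" "v \<in> X - {x}"
  have "(\<lambda>a b. a \<in> X \<and> b \<in> X \<and> adj G a b)\<^sup>*\<^sup>* u v"
    using con uv unfolding connected_in_def by blast
  \<comment> \<open>A walk enters and leaves \<open>x\<close> only through \<open>y\<close>; while
    it is at \<open>x\<close>, the walk avoiding \<open>x\<close> waits at \<open>y\<close>.\<close>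
  then have "if v = x then ?R\<^sup>*\<^sup>* u y else ?R\<^sup>*\<^sup>* u v"
  proof induction
    case base
    then show ?case using uv by simp
  next
    case (step w w')
    have ww: "w \<noteq> w'" using step by (auto simp: adj_def)
    show ?case
    proof (cases "w = x \<or> w' = x")
      case True
      then show ?thesis using step ww leaf adj_sym[of G] by (auto split: if_splits)
    next
      case False
      then have "?R\<^sup>*\<^sup>* u w" "?R w w'" using step by auto
      then show ?thesis using False by (simp add: rtranclp.rtrancl_into_rtrancl)
    qed
  qed
  then show "?R\<^sup>*\<^sup>* u v" using uv by simp
qed

text \<open>Induction by deleting a leaf \<open>x\<close>. If some subtree is \<open>{x}\<close>,
  then \<open>x\<close> is common to all. Otherwise every subtree containing \<open>x\<close> also
  contains its neighbour \<open>y\<close>, so the subtrees still meet pairwise after the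
  deletion.\<close>

lemma Helly_subtrees:
  assumes "finite V" "V \<subseteq> verts G" "\<not> has_cycle G" "I \<noteq> {}"
    and "\<And>i. i \<in> I \<Longrightarrow> S i \<subseteq> V" "\<And>i. i \<in> I \<Longrightarrow> connected_in G (S i)"
    and "\<And>i j. i \<in> I \<Longrightarrow> j \<in> I \<Longrightarrow> S i \<inter> S j \<noteq> {}"
  shows "\<exists>x\<in>V. \<forall>i\<in>I. x \<in> S i"
  using assms
proof (induction V arbitrary: S rule: finite_psubset_induct)
  case (psubset V)
  have "V \<noteq> {}" using psubset.prems by fast
  then obtain x y where x: "x \<in> V" and leaf: "\<And>z. z \<in> V \<Longrightarrow> adj G x z \<Longrightarrow> z = y"
    using acyclic_has_leaf[OF psubset.hyps(1)] psubset.prems by metis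
  show ?case
  proof (cases "\<exists>i\<in>I. S i = {x}")
    case True
    then obtain i where i: "i \<in> I" "S i = {x}" by blast
    have "x \<in> S j" if "j \<in> I" for j using psubset.prems(6)[OF i(1) that] i(2) by simp
    then show ?thesis using x by blast
  next
    case False
    have y: "y \<in> S i \<and> y \<noteq> x" if i: "i \<in> I" "x \<in> S i" for i
    proof -
      obtain w where w: "w \<in> S i" "w \<noteq> x" using False i by blast
      have "(\<lambda>a b. a \<in> S i \<and> b \<in> S i \<and> adj G a b)\<^sup>*\<^sup>* x w"
        using psubset.prems(5)[OF i(1)] w i unfolding connected_in_def by blast
      then obtain z where "z \<in> S i" "adj G x z" using w by (auto elim: converse_rtranclpE)
      then show ?thesis using leaf psubset.prems(4)[OF i(1)] by (auto simp: adj_def)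
    qed
    have "\<exists>z\<in>V - {x}. \<forall>i\<in>I. z \<in> S i - {x}"
    proof (rule psubset.IH)
      fix i j assume ij: "i \<in> I" "j \<in> I"
      obtain z where "z \<in> S i \<inter> S j" using psubset.prems(6)[OF ij] by blast
      then show "(S i - {x}) \<inter> (S j - {x}) \<noteq> {}" using y[OF ij(1)] y[OF ij(2)] by (cases "z = x") auto
    next
      fix i assume i: "i \<in> I"
      show "connected_in G (S i - {x})"
        using connected_in_remove_leaf psubset.prems(4,5)[OF i] leaf by (metis subsetD)
      show "S i - {x} \<subseteq> V - {x}" using psubset.prems(4)[OF i] by blast
    next
      show "V - {x} \<subset> V" using x by blast
      show "V - {x} \<subseteq> verts G" using psubset.prems(1) by blast
      show "\<not> has_cycle G" "I \<noteq> {}" using psubset.prems(2,3) .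
    qed
    then show ?thesis by blast
  qed
qed

text \<open>The tree nodes whose bags meet a branch set \<open>L i\<close> form a subtree. Touching
  branch sets give intersecting subtrees, and the Helly property provides a common node.\<close>

lemma minor_in_bag:
  fixes L :: "nat \<Rightarrow> 'a set"
  assumes td: "tree_decomposition G T B" and l: "0 < l"
    and sub: "\<And>i. i < l \<Longrightarrow> L i \<subseteq> verts G" and ne: "\<And>i. i < l \<Longrightarrow> L i \<noteq> {}"
    and con: "\<And>i. i < l \<Longrightarrow> connected_in G (L i)"
    and touch: "\<And>i j. i < j \<Longrightarrow> j < l \<Longrightarrow> \<exists>u\<in>L i. \<exists>v\<in>L j. adj G u v"
  shows "\<exists>t\<in>verts T. \<forall>i<l. B t \<inter> L i \<noteq> {}"
proof -
  define S where "S i = {t \<in> verts T. B t \<inter> L i \<noteq> {}}" for i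
  have T: "finite (verts T)" "\<not> has_cycle T"
    using td by (auto simp: tree_decomposition_def is_tree_def finite_graph_def)
  have edge: "\<exists>t\<in>verts T. u \<in> B t \<and> v \<in> B t" if "adj G u v" for u v
    using td that by (auto simp: tree_decomposition_def)
  have conS: "connected_in T (S i)" if i: "i < l" for i
    unfolding connected_in_def
  proof (intro ballI)
    let ?R = "\<lambda>a b. a \<in> S i \<and> b \<in> S i \<and> adj T a b"
    fix s t assume st: "s \<in> S i" "t \<in> S i"
    obtain u v where u: "u \<in> B s" "u \<in> L i" and v: "v \<in> B t" "v \<in> L i"
      using st by (auto simp: S_def)
    have same: "?R\<^sup>*\<^sup>* a b" if w: "w \<in> L i" and ab: "a \<in> verts T" "b \<in> verts T" "w \<in> B a" "w \<in> B b" for a b w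
    proof -
      let ?Q = "{t \<in> verts T. w \<in> B t}"
      have "(\<lambda>x y. x \<in> ?Q \<and> y \<in> ?Q \<and> adj T x y)\<^sup>*\<^sup>* a b"
        using td w ab sub[OF i] unfolding tree_decomposition_def connected_in_def by blast
      then show ?thesis by (rule rtranclp_mono[THEN predicate2D, rotated]) (use w in \<open>auto simp: S_def\<close>)
    qed
    have "(\<lambda>x y. x \<in> L i \<and> y \<in> L i \<and> adj G x y)\<^sup>*\<^sup>* u v"
      using con[OF i] u v unfolding connected_in_def by blast
    \<comment> \<open>Quantifying over all nodes whose bag holds the current vertex lets the
      induction pass through a bag that contains the next edge.\<close>
    then have "\<forall>b\<in>verts T. v \<in> B b \<longrightarrow> ?R\<^sup>*\<^sup>* s b"
    proof induction
      case base
      then show ?case using same u st by (auto simp: S_def)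
    next
      case (step w w')
      obtain c where "c \<in> verts T" "w \<in> B c" "w' \<in> B c" using edge step by blast
      then show ?case using step same[of w' c] by (meson rtranclp_trans)
    qed
    then show "?R\<^sup>*\<^sup>* s t" using v st by (auto simp: S_def)
  qed
  have "S i \<inter> S j \<noteq> {}" if "i < l" "j < l" "i < j" for i j
  proof -
    obtain u v where "u \<in> L i" "v \<in> L j" "adj G u v" using touch \<open>i < j\<close> \<open>j < l\<close> by blast
    then show ?thesis using edge[of u v] by (auto simp: S_def)
  qed
  moreover have "S i \<noteq> {}" if "i < l" for i
    using ne[OF that] sub[OF that] td by (fastforce simp: S_def tree_decomposition_def)
  ultimately have "S i \<inter> S j \<noteq> {}" if "i < l" "j < l" for i j
    using that by (metis Int_absorb inf_commute linorder_neqE_nat)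
  then have "\<exists>t\<in>verts T. \<forall>i\<in>{..<l}. t \<in> S i"
    using T conS l by (intro Helly_subtrees) (auto simp: S_def)
  then show ?thesis by (auto simp: S_def)
qed

section \<open>Graphs induced by a relation on a vertex set\<close>

definition rel_graph :: "('a \<Rightarrow> 'a \<Rightarrow> bool) \<Rightarrow> 'a set \<Rightarrow> 'a graph" where
  "rel_graph R S = (S, {{u, v} | u v. u \<in> S \<and> v \<in> S \<and> u \<noteq> v \<and> R u v})"

lemma verts_rel_graph [simp]: "verts (rel_graph R S) = S"
  by (simp add: rel_graph_def verts_def)

lemma adj_rel_graph:
  assumes "symp R"
  shows "adj (rel_graph R S) u v \<longleftrightarrow> u \<in> S \<and> v \<in> S \<and> u \<noteq> v \<and> R u v"
  using assms by (auto simp: adj_def rel_graph_def edges_def doubleton_eq_iff dest: sympD)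

lemma finite_rel_graph: "finite S \<Longrightarrow> finite_graph (rel_graph R S)"
  by (auto simp: finite_graph_def rel_graph_def verts_def edges_def)

lemma induced_rel_graph:
  "S' \<subseteq> S \<Longrightarrow> induced_subgraph (rel_graph R S) S' = rel_graph R S'"
  by (auto simp: induced_subgraph_def rel_graph_def edges_def)

lemma hereditary_rel_graphs: "hereditary {rel_graph R S | S. finite S}"
  unfolding hereditary_def using induced_rel_graph finite_subset by fastforce

section \<open>A layered wheel over an infinite forest\<close>

text \<open>The node \<open>n\<close> of layer \<open>d\<close> is the pair \<open>(d, n)\<close>; its children are \<open>(d + 1, K * n + a)\<close> for \<open>a < K\<close>,
  where \<open>sl a\<close> and \<open>ad a\<close> are the slot and the adjacency set that \<open>a\<close> encodes. Layers are
  infinite to the right (layer \<open>0\<close> has infinitely many roots), so that only the left end of a layer is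
  special.\<close>

locale wheel =
  fixes h K :: nat and sl :: "nat \<Rightarrow> nat" and ad :: "nat \<Rightarrow> nat set"
  assumes two_le_h: "2 \<le> h"
    and sl_less: "a < K \<Longrightarrow> sl a < h"
    and letters: "k < h \<Longrightarrow> A \<subseteq> {..<h} \<Longrightarrow> \<exists>a<K. sl a = k \<and> ad a = A"
begin

abbreviation letter :: "nat \<times> nat \<Rightarrow> nat" where "letter x \<equiv> snd x mod K"

definition par :: "nat \<times> nat \<Rightarrow> nat \<times> nat" where "par x = (fst x - 1, snd x div K)"

primrec content :: "nat \<Rightarrow> nat \<Rightarrow> nat \<Rightarrow> (nat \<times> nat) option" where
  "content 0 n = [sl (n mod K) \<mapsto> (0, n)]"
| "content (Suc d) n = (content d (n div K))(sl (n mod K) \<mapsto> (Suc d, n))"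

definition cont :: "nat \<times> nat \<Rightarrow> nat \<Rightarrow> (nat \<times> nat) option" where
  "cont x = content (fst x) (snd x)"

text \<open>\<open>cont x\<close> is the memory after \<open>x\<close> has stored itself. Hence the
  condition \<open>y \<noteq> x\<close>, and hence the former holder of the overwritten slot is not
  joined to \<open>x\<close>.\<close>

definition down :: "nat \<times> nat \<Rightarrow> nat \<times> nat \<Rightarrow> bool" where
  "down x y \<longleftrightarrow> y \<noteq> x \<and> (\<exists>i\<in>ad (letter x). cont x i = Some y)"

definition W :: "nat \<times> nat \<Rightarrow> nat \<times> nat \<Rightarrow> bool" where
  "W x y \<longleftrightarrow> down x y \<or> down y x \<or>
    (fst x = fst y \<and> (snd x = Suc (snd y) \<or> snd y = Suc (snd x)))"

lemma K_pos: "0 < K"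
  using letters[of 0 "{}"] two_le_h by auto

lemma sl_letter: "sl (n mod K) < h"
  by (simp add: K_pos sl_less)

lemma W_sym: "W x y \<longleftrightarrow> W y x"
  by (auto simp: W_def)

lemma cont_letter: "cont x (sl (letter x)) = Some x"
  by (cases x; cases "fst x") (auto simp: cont_def)

lemma cont_other:
  assumes "0 < fst x" "i \<noteq> sl (letter x)" shows "cont x i = cont (par x) i"
  using assms by (cases x; cases "fst x") (auto simp: cont_def par_def)

text \<open>A node writes itself only into the slot of its own letter, so different slots hold
  different nodes.\<close>

lemma contentD:
  "content d n i = Some y \<Longrightarrow> sl (letter y) = i \<and> (y = (d, n) \<or> fst y < d)"
proof (induction d arbitrary: n)
  case (Suc d)
  then show ?case by (fastforce split: if_splits)
qed (auto split: if_splits)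

lemma contD:
  assumes "cont x i = Some y"
  shows "sl (letter y) = i" "y = x \<or> fst y < fst x" "i < h"
  using contentD[of "fst x" "snd x" i y] assms sl_letter[of "snd y"] by (auto simp: cont_def)

lemma downD: "down x y \<Longrightarrow> fst y < fst x"
  unfolding down_def using contD(2) by blast

lemma W_irrefl: "\<not> W x x"
  by (auto simp: W_def down_def)

definition bag :: "nat \<times> nat \<Rightarrow> (nat \<times> nat) set" where "bag x = {y. \<exists>i. cont x i = Some y}"

lemma bag_subset: "bag x \<subseteq> (\<lambda>i. the (cont x i)) ` {..<h}"
proof
  fix y assume "y \<in> bag x"
  then obtain i where "cont x i = Some y" by (auto simp: bag_def)
  then show "y \<in> (\<lambda>i. the (cont x i)) ` {..<h}" using contD(3) by (intro image_eqI[of _ _ i]) auto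
qed

lemma finite_bag: "finite (bag x)" and card_bag: "card (bag x) \<le> h"
  using finite_subset[OF bag_subset] card_mono[OF _ bag_subset, of x]
    card_image_le[of "{..<h}" "\<lambda>i. the (cont x i)"] by auto

lemma self_in_bag: "x \<in> bag x"
  using cont_letter[of x] by (auto simp: bag_def)

lemma down_in_bag: "down x y \<Longrightarrow> y \<in> bag x"
  by (auto simp: down_def bag_def)

lemma bag_parent:
  assumes "y \<in> bag x" "y \<noteq> x" shows "0 < fst x \<and> y \<in> bag (par x)"
proof -
  obtain i where i: "cont x i = Some y" using assms by (auto simp: bag_def)
  then have "0 < fst x" "i \<noteq> sl (letter x)" using contD(2)[OF i] assms(2) cont_letter[of x] by auto
  then show ?thesis using i cont_other by (auto simp: bag_def)
qed

section \<open>Excluding bicliques\<close>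

lemma no_biclique:
  assumes "finite A" "finite B" "A \<inter> B = {}" "card A = h + 3" "card B = h + 3"
    and W: "\<And>a b. a \<in> A \<Longrightarrow> b \<in> B \<Longrightarrow> W a b"
  shows False
proof -
  \<comment> \<open>A vertex of maximal depth has few neighbours that are not deeper than itself.\<close>
  have few: False if "card S = h + 3" "\<And>y. y \<in> S \<Longrightarrow> W x y \<and> fst y \<le> fst x" for x S
  proof -
    let ?S = "bag x \<union> {(fst x, snd x - 1), (fst x, Suc (snd x))}"
    have "S \<subseteq> ?S"
    proof
      fix y assume "y \<in> S"
      then have y: "W x y" "fst y \<le> fst x" using that by auto
      then consider "down x y" | "fst y = fst x" "snd y = snd x - 1 \<or> snd y = Suc (snd x)"
        using downD[of y x] unfolding W_def by force
      then show "y \<in> ?S" using down_in_bag by cases (auto simp: prod_eq_iff)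
    qed
    then have "card S \<le> card ?S" using finite_bag by (intro card_mono) auto
    also have "\<dots> \<le> card (bag x) + card {(fst x, snd x - 1), (fst x, Suc (snd x))}"
      by (rule card_Un_le)
    also have "\<dots> \<le> h + 2" using card_bag[of x] by (auto simp: card_insert_if)
    finally show False using that by simp
  qed
  let ?F = "fst ` (A \<union> B)"
  have "?F \<noteq> {}" "finite ?F" using assms(1,2,4) by auto
  then have "Max ?F \<in> ?F" by (intro Max_in)
  then obtain x where x: "x \<in> A \<union> B" "fst x = Max ?F" by (metis imageE)
  then have le: "fst y \<le> fst x" if "y \<in> A \<union> B" for y using that \<open>finite ?F\<close> by simp
  show False
  proof (cases "x \<in> A")
    case True then show False using few[of B x] assms le by blast
  next
    case False then show False using few[of A x] assms le x W_sym by blast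
  qed
qed

section \<open>Touching layers and unbounded treewidth\<close>

lemma layers_touch:
  assumes "d < e" "e < l"
  shows "\<exists>m n. m < K ^ l \<and> n < K ^ l \<and> W (d, m) (e, n)"
proof -
  obtain a where a: "a < K" "sl a = 0" using letters[of 0 "{}"] two_le_h by auto
  obtain b where b: "b < K" "sl b = 1" "ad b = {0}" using letters[of 1 "{0}"] two_le_h by auto
  \<comment> \<open>\<open>(d, a)\<close> stores itself in slot 0. Children with letter
    \<open>b\<close> overwrite only slot 1 and are joined to slot 0, so each node on the chain of
    such children below \<open>(d, a)\<close> is adjacent to it.\<close>
  have "\<exists>n. n < K ^ Suc j \<and> cont (d + j, n) 0 = Some (d, a) \<and> (j > 0 \<longrightarrow> n mod K = b)" for j
  proof (induction j)
    case 0
    then show ?case using a cont_letter[of "(d, a)"] by auto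
  next
    case (Suc j)
    then obtain n where n: "n < K ^ Suc j" "cont (d + j, n) 0 = Some (d, a)" by blast
    let ?n = "K * n + b"
    have "?n < K * Suc n" using b by simp
    also have "\<dots> \<le> K * K ^ Suc j" using n(1) by (intro mult_le_mono2) simp
    finally have "?n < K ^ Suc (Suc j)" by simp
    moreover have "?n mod K = b" "?n div K = n" using b K_pos by auto
    ultimately show ?case using n(2) cont_other[of "(d + Suc j, ?n)" 0] b
      by (intro exI[of _ ?n]) (auto simp: par_def)
  qed
  from this[of "e - d"] obtain n where n: "n < K ^ Suc (e - d)" "cont (e, n) 0 = Some (d, a)" "n mod K = b"
    using assms by auto
  have "down (e, n) (d, a)" using n b assms by (auto simp: down_def)
  moreover have "K ^ Suc (e - d) \<le> K ^ l" "K \<le> K ^ l"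
    using assms K_pos power_increasing[of "Suc (e - d)" l K] power_increasing[of 1 l K] by auto
  ultimately show ?thesis using n a by (intro exI[of _ a] exI[of _ n]) (auto simp: W_def)
qed

definition W_graph :: "(nat \<times> nat) set \<Rightarrow> nat graph" where
  "W_graph X = rel_graph (\<lambda>u v. W (prod_decode u) (prod_decode v)) (prod_encode ` X)"

lemma verts_W_graph [simp]: "verts (W_graph X) = prod_encode ` X"
  by (simp add: W_graph_def)

lemma adj_W_graph: "adj (W_graph X) (prod_encode x) (prod_encode y) \<longleftrightarrow> x \<in> X \<and> y \<in> X \<and> W x y"
proof -
  have "symp (\<lambda>u v. W (prod_decode u) (prod_decode v))" by (intro sympI) (simp add: W_sym)
  then show ?thesis using W_irrefl[of x] by (auto simp: W_graph_def adj_rel_graph)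
qed

lemma W_graph_no_Ktt: "\<not> contains_Ktt (W_graph X) (h + 3)"
proof
  assume "contains_Ktt (W_graph X) (h + 3)"
  then obtain A B where AB: "A \<subseteq> prod_encode ` X" "B \<subseteq> prod_encode ` X" "A \<inter> B = {}"
    "card A = h + 3" "card B = h + 3" "finite A" "finite B"
    and adj: "\<And>a b. a \<in> A \<Longrightarrow> b \<in> B \<Longrightarrow> adj (W_graph X) a b"
    unfolding contains_Ktt_def by auto
  have inj: "inj_on prod_decode Z" for Z by (rule inj_on_subset[OF inj_prod_decode subset_UNIV])
  show False
  proof (rule no_biclique[of "prod_decode ` A" "prod_decode ` B"])
    show "prod_decode ` A \<inter> prod_decode ` B = {}" using AB(3) by (auto dest: injD[OF inj_prod_decode])
  next
    fix a b assume "a \<in> prod_decode ` A" "b \<in> prod_decode ` B"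
    then have "prod_encode a \<in> A" "prod_encode b \<in> B" by auto
    then show "W a b" using adj adj_W_graph by blast
  qed (use AB card_image[OF inj] in auto)
qed

lemma W_graph_large_treewidth: "\<exists>X. finite X \<and> \<not> treewidth_le (W_graph X) k"
proof (intro exI conjI notI)
  \<comment> \<open>A bag meeting \<open>l\<close> disjoint layers has at least \<open>k + 2\<close>
    elements, one more than width \<open>k\<close> allows.\<close>
  define l where "l = k + 2"
  let ?X = "{..<l} \<times> {..<K ^ l}"
  show "finite ?X" by simp
  assume "treewidth_le (W_graph ?X) k"
  then obtain T B where td: "tree_decomposition (W_graph ?X) T B"
    and small: "\<And>t. t \<in> verts T \<Longrightarrow> card (B t) \<le> k + 1"
    unfolding treewidth_le_def by auto
  define L where "L i = (\<lambda>n. prod_encode (i, n)) ` {..<K ^ l}" for i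
  have "\<exists>t\<in>verts T. \<forall>i<l. B t \<inter> L i \<noteq> {}"
  proof (rule minor_in_bag[OF td])
    fix i assume i: "i < l"
    show "L i \<subseteq> verts (W_graph ?X)" using i by (auto simp: L_def)
    show "L i \<noteq> {}" using K_pos by (auto simp: L_def lessThan_empty_iff)
    show "connected_in (W_graph ?X) (L i)"
    proof (rule connected_in_star)
      fix u assume "u \<in> L i"
      then obtain n where n: "u = prod_encode (i, n)" "n < K ^ l" by (auto simp: L_def)
      let ?R = "\<lambda>x y. x \<in> L i \<and> y \<in> L i \<and> adj (W_graph ?X) x y"
      have "?R\<^sup>*\<^sup>* (prod_encode (i, n)) (prod_encode (i, 0))" using n(2)
      proof (induction n)
        case (Suc n)
        have "W (i, Suc n) (i, n)" by (simp add: W_def)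
        then have "?R (prod_encode (i, Suc n)) (prod_encode (i, n))"
          using Suc.prems i by (auto simp: L_def adj_W_graph)
        moreover have "?R\<^sup>*\<^sup>* (prod_encode (i, n)) (prod_encode (i, 0))"
          using Suc by simp
        ultimately show ?case by (rule converse_rtranclp_into_rtranclp)
      qed simp
      then show "?R\<^sup>*\<^sup>* u (prod_encode (i, 0))" using n(1) by simp
    qed
  next
    fix i j assume ij: "i < j" "j < l"
    then obtain m n where "m < K ^ l" "n < K ^ l" "W (i, m) (j, n)" using layers_touch by blast
    then show "\<exists>u\<in>L i. \<exists>v\<in>L j. adj (W_graph ?X) u v"
      using ij by (auto simp: L_def adj_W_graph)
  qed (simp add: l_def)
  then obtain t where t: "t \<in> verts T" "\<And>i. i < l \<Longrightarrow> \<exists>v. v \<in> B t \<inter> L i" by blast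
  then obtain f where f: "\<And>i. i < l \<Longrightarrow> f i \<in> B t \<inter> L i" by metis
  have "inj_on f {..<l}"
  proof (rule inj_onI)
    fix i j assume "i \<in> {..<l}" "j \<in> {..<l}" "f i = f j"
    then have "f i \<in> L i \<inter> L j" using f by force
    then show "i = j" by (auto simp: L_def)
  qed
  moreover have "f ` {..<l} \<subseteq> B t" using f by blast
  moreover have "B t \<subseteq> prod_encode ` ?X"
    using td t(1) unfolding tree_decomposition_def by simp
  then have "finite (B t)" by (rule finite_subset) simp
  ultimately have "l \<le> card (B t)" using card_inj_on_le by fastforce
  then show False using small[OF t(1)] by (simp add: l_def)
qed

end

section \<open>Cut paths in induced subgraphs\<close>

text \<open>\<open>E\<close> stands for the adjacency of the forbidden graph, carried over to the
  slots \<open>{..<h}\<close>, and \<open>no_copy\<close> says that \<open>X\<close> induces no copy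
  of it.\<close>

locale wheel_sub = wheel +
  fixes X :: "(nat \<times> nat) set" and E :: "nat \<Rightarrow> nat \<Rightarrow> bool"
  assumes E_sym: "E i j \<longleftrightarrow> E j i"
    and no_copy: "inj_on f {..<h} \<Longrightarrow> f ` {..<h} \<subseteq> X \<Longrightarrow>
      \<exists>i<h. \<exists>j<h. i \<noteq> j \<and> \<not> (W (f i) (f j) \<longleftrightarrow> E i j)"
begin

section \<open>Embedded prefixes of the forbidden graph\<close>

definition good :: "nat \<times> nat \<Rightarrow> nat \<Rightarrow> bool" where
  "good x k \<longleftrightarrow> (\<forall>i<k. \<exists>y\<in>X. cont x i = Some y) \<and>
    (\<forall>i<k. \<forall>j<k. i \<noteq> j \<longrightarrow> (W (the (cont x i)) (the (cont x j)) \<longleftrightarrow> E i j))"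

definition prefix :: "nat \<times> nat \<Rightarrow> nat" where "prefix x = (GREATEST k. good x k)"

text \<open>Otherwise the first \<open>h\<close> slots would hold a copy excluded by
  \<open>no_copy\<close>. The bound also makes \<open>GREATEST\<close> in \<open>prefix\<close>
  meaningful.\<close>

lemma good_less: assumes "good x k" shows "k < h"
proof (rule ccontr)
  assume "\<not> k < h"
  then have g: "good x h" using assms by (auto simp: good_def)
  let ?f = "\<lambda>i. the (cont x i)"
  have f: "\<exists>y\<in>X. cont x i = Some y" if "i < h" for i
    using g that unfolding good_def by blast
  have "inj_on ?f {..<h}"
  proof (rule inj_onI)
    fix i j assume ij: "i \<in> {..<h}" "j \<in> {..<h}" "?f i = ?f j"
    obtain y z where "cont x i = Some y" "cont x j = Some z" using f ij(1,2) by blast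
    then show "i = j" using contD(1) ij(3) by (metis option.sel)
  qed
  moreover have "?f ` {..<h} \<subseteq> X" using f by fastforce
  ultimately obtain i j where "i < h" "j < h" "i \<noteq> j" "\<not> (W (?f i) (?f j) \<longleftrightarrow> E i j)"
    using no_copy[of ?f] by blast
  then show False using g unfolding good_def by blast
qed

lemma good_prefix: "good x (prefix x)"
  unfolding prefix_def
proof (rule GreatestI_nat[of "good x" 0 h])
  show "good x 0" by (simp add: good_def)
qed (use good_less less_imp_le in blast)

lemma le_prefix: "good x k \<Longrightarrow> k \<le> prefix x"
  unfolding prefix_def using good_less less_imp_le by (intro Greatest_le_nat[of _ _ h]) blast+

lemma prefix_less: "prefix x < h"
  using good_less good_prefix by blast

definition step :: "nat \<times> nat \<Rightarrow> nat" where
  "step x = (SOME a. a < K \<and> sl a = prefix x \<and> ad a = {i. i < prefix x \<and> E i (prefix x)})"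

definition nxt :: "nat \<times> nat \<Rightarrow> nat \<times> nat" where "nxt x = (Suc (fst x), K * snd x + step x)"

lemma step: "step x < K" "sl (step x) = prefix x" "ad (step x) = {i. i < prefix x \<and> E i (prefix x)}"
proof -
  have "\<exists>a. a < K \<and> sl a = prefix x \<and> ad a = {i. i < prefix x \<and> E i (prefix x)}"
    by (rule letters) (use prefix_less[of x] in auto)
  from someI_ex[OF this] show "step x < K" "sl (step x) = prefix x"
    "ad (step x) = {i. i < prefix x \<and> E i (prefix x)}" unfolding step_def by auto
qed

lemma par_nxt: "par (nxt x) = x" and letter_nxt: "letter (nxt x) = step x"
  using step(1)[of x] by (auto simp: nxt_def par_def)

lemma cont_nxt: "cont (nxt x) i = (if i = prefix x then Some (nxt x) else cont x i)"
proof (cases "i = prefix x")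
  case True
  then show ?thesis using cont_letter[of "nxt x"] by (simp add: letter_nxt step)
next
  case False
  have "0 < fst (nxt x)" by (simp add: nxt_def)
  then show ?thesis using cont_other[of "nxt x" i] False by (simp add: letter_nxt step par_nxt)
qed

text \<open>The chosen child overwrites only the slot just after the prefix, so the prefix survives.
  Its adjacency set is the one \<open>E\<close> prescribes for the next vertex, so the prefix grows
  if the child lies in \<open>X\<close>.\<close>

lemma prefix_nxt:
  "prefix x \<le> prefix (nxt x)" "nxt x \<in> X \<Longrightarrow> prefix x < prefix (nxt x)"
proof -
  let ?k = "prefix x"
  have g: "good x ?k" by (rule good_prefix)
  then have g': "good (nxt x) ?k" by (simp add: good_def cont_nxt)
  then show "?k \<le> prefix (nxt x)" by (rule le_prefix)
  assume X: "nxt x \<in> X"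
  have key: "W (nxt x) (the (cont x i)) \<longleftrightarrow> E i ?k" if i: "i < ?k" for i
  proof -
    obtain y where y: "cont x i = Some y" using g i by (auto simp: good_def)
    have lt: "fst y < fst (nxt x)" using contD(2)[OF y] by (auto simp: nxt_def)
    \<comment> \<open>As \<open>y\<close> is strictly less deep, layer edges and edges down from
      \<open>y\<close> are impossible.\<close>
    have "W (nxt x) y \<longleftrightarrow> down (nxt x) y" using lt downD[of y "nxt x"] by (auto simp: W_def)
    also have "\<dots> \<longleftrightarrow> i \<in> ad (step x)"
    proof
      assume "down (nxt x) y"
      then obtain j where "j \<in> ad (step x)" "cont (nxt x) j = Some y"
        by (auto simp: down_def letter_nxt)
      then show "i \<in> ad (step x)" using contD(1)[OF y] contD(1) by metis
    next
      assume "i \<in> ad (step x)"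
      then show "down (nxt x) y" using y i lt
        unfolding down_def by (intro conjI bexI[of _ i]) (auto simp: letter_nxt cont_nxt)
    qed
    finally show ?thesis using i y by (simp add: step)
  qed
  have "good (nxt x) (Suc ?k)"
    unfolding good_def
  proof (intro conjI allI impI)
    fix i assume "i < Suc ?k"
    then show "\<exists>y\<in>X. cont (nxt x) i = Some y" using g X by (auto simp: good_def cont_nxt)
  next
    fix i j assume "i < Suc ?k" "j < Suc ?k" "i \<noteq> j"
    then show "W (the (cont (nxt x) i)) (the (cont (nxt x) j)) \<longleftrightarrow> E i j"
      using g key[of i] key[of j] W_sym E_sym
      by (cases "i = ?k"; cases "j = ?k") (auto simp: good_def cont_nxt)
  qed
  from le_prefix[OF this] show "?k < prefix (nxt x)" by simp
qed

section \<open>Orbits of the downward walk\<close>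

definition orbit :: "nat \<times> nat \<Rightarrow> (nat \<times> nat) set" where "orbit x = range (\<lambda>j. (nxt ^^ j) x)"

lemma self_in_orbit: "x \<in> orbit x"
  unfolding orbit_def by (rule range_eqI[of _ _ 0]) simp

lemma orbit_nxt: "orbit (nxt x) \<subseteq> orbit x"
  unfolding orbit_def
proof (rule image_subsetI)
  fix j show "(nxt ^^ j) (nxt x) \<in> range (\<lambda>j. (nxt ^^ j) x)"
    by (rule range_eqI[of _ _ "Suc j"]) (simp add: funpow_swap1)
qed

lemma orbit_bound: "finite (orbit x \<inter> X) \<and> card (orbit x \<inter> X) \<le> Suc h"
proof -
  let ?o = "\<lambda>j. (nxt ^^ j) x"
  have mono: "prefix (?o i) \<le> prefix (?o j)" if "i \<le> j" for i j
    using that by (rule lift_Suc_mono_le[of "\<lambda>j. prefix (?o j)", rotated]) (simp add: prefix_nxt)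
  have less: "prefix (?o i) < prefix (?o j)" if "i < j" "?o j \<in> X" for i j
  proof -
    obtain k where "j = Suc k" "i \<le> k" using \<open>i < j\<close> by (cases j) auto
    then show ?thesis using mono[of i k] prefix_nxt(2)[of "?o k"] that by simp
  qed
  \<comment> \<open>The start is set aside because it may lie in \<open>X\<close> without having
    lengthened a prefix; it accounts for the successor in \<open>Suc h\<close>.\<close>
  let ?S = "orbit x \<inter> X - {x}"
  have inj: "inj_on prefix ?S"
  proof (rule inj_onI)
    fix y z assume yz: "y \<in> ?S" "z \<in> ?S" "prefix y = prefix z"
    then obtain i j where "y = ?o i" "z = ?o j" by (auto simp: orbit_def)
    then show "y = z" using less[of i j] less[of j i] yz by (cases i j rule: linorder_cases) auto
  qed
  have sub: "prefix ` ?S \<subseteq> {..<h}" using prefix_less by auto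
  have "finite ?S" by (rule inj_on_finite[OF inj sub]) simp
  moreover have "card ?S \<le> h" using card_inj_on_le[OF inj sub] by simp
  moreover have "orbit x \<inter> X \<subseteq> insert x ?S" by blast
  moreover have "card (insert x ?S) \<le> Suc (card ?S)" by (rule card_insert_le_m1) auto
  ultimately show ?thesis by (meson card_mono finite_insert finite_subset le_trans Suc_le_mono)
qed

text \<open>A chained node continues the orbit of its parent; at the other nodes a new maximal orbit
  starts.\<close>

definition chained :: "nat \<times> nat \<Rightarrow> bool" where "chained x \<longleftrightarrow> 0 < fst x \<and> nxt (par x) = x"

lemma chained_iff: "chained x \<longleftrightarrow> x \<in> range nxt"
proof
  assume "x \<in> range nxt"
  then show "chained x" by (auto simp: chained_def par_nxt) (auto simp: nxt_def)
qed (auto simp: chained_def intro: range_eqI[OF sym])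

text \<open>\<open>nxt\<close> is injective with left inverse \<open>par\<close>, so orbits sharing
  a node are nested, and the start of the inner one is chained unless both starts agree.\<close>

lemma orbit_start_unique:
  assumes "y \<in> orbit s" "y \<in> orbit t" "\<not> chained s" "\<not> chained t"
  shows "s = t"
proof -
  have inj: "inj nxt" by (metis injI par_nxt)
  have *: "a = b" if "(nxt ^^ i) a = (nxt ^^ j) b" "i \<le> j" "\<not> chained a" for a b i j
  proof -
    have "(nxt ^^ i) a = (nxt ^^ i) ((nxt ^^ (j - i)) b)"
      using that funpow_add[of i "j - i" nxt] by simp
    then have "a = (nxt ^^ (j - i)) b" using inj_fn[OF inj, of i] by (simp add: inj_eq)
    then show ?thesis using that(3) by (cases "j - i") (auto simp: chained_iff)
  qed
  obtain i j where "y = (nxt ^^ i) s" "y = (nxt ^^ j) t" using assms unfolding orbit_def by blast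
  then show ?thesis using *[of i s j t] *[of j t i s] assms by (cases "i \<le> j") auto
qed

section \<open>Separators made of memory and orbit\<close>

definition M :: "nat \<times> nat \<Rightarrow> (nat \<times> nat) set" where "M x = (bag x \<union> orbit x) \<inter> X"

lemma finite_M: "finite (M x)" and card_M: "card (M x) \<le> 2 * h + 1"
proof -
  have M: "M x = bag x \<inter> X \<union> orbit x \<inter> X" by (auto simp: M_def)
  show "finite (M x)" using finite_bag orbit_bound M by auto
  have "card (bag x \<inter> X) \<le> h" using card_bag finite_bag by (meson card_mono inf_le1 le_trans)
  then show "card (M x) \<le> 2 * h + 1"
    using card_Un_le[of "bag x \<inter> X" "orbit x \<inter> X"] orbit_bound[of x] unfolding M by linarith
qed

text \<open>Memory entries other than \<open>x\<close> are inherited from the parent, and so is the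
  orbit if \<open>x\<close> is chained. Something new enters only at the start of its orbit.\<close>

lemma M_parent:
  assumes "y \<in> M x"
  shows "(y \<in> orbit x \<and> \<not> chained x) \<or> (0 < fst x \<and> y \<in> M (par x))"
proof (cases "y \<in> orbit x")
  case True
  then show ?thesis using orbit_nxt[of "par x"] assms by (auto simp: chained_def M_def)
next
  case False
  then have "y \<noteq> x" using self_in_orbit by blast
  then show ?thesis using False bag_parent[of y x] assms by (auto simp: M_def)
qed

lemma M_chained:
  assumes "y \<in> M x" "chained x" shows "y \<in> M (par x)"
  using M_parent[OF assms(1)] assms(2) by blast

section \<open>The tree of gaps\<close>

text \<open>The pair \<open>(d, m)\<close> also denotes the gap of layer \<open>d\<close> between the nodes \<open>(d, m - 1)\<close> and \<open>(d, m)\<close>,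
  bounded by the orbits of these two nodes. The orbits of layer \<open>d - 1\<close> cut the gaps of layer \<open>d\<close> into
  groups; \<open>region\<close> sends a gap to the gap of layer \<open>d - 1\<close> enclosing its group. In the decomposition
  tree each group is a chain from left to right, hanging from the gap that encloses it.\<close>

definition region :: "nat \<times> nat \<Rightarrow> nat \<times> nat" where
  "region x = (if snd x \<le> snd (nxt (par x)) then par x else (fst (par x), Suc (snd (par x))))"

definition gap_parent :: "nat \<times> nat \<Rightarrow> nat \<times> nat" where
  "gap_parent x = (if 0 < snd x \<and> \<not> chained (fst x, snd x - 1) then (fst x, snd x - 1) else region x)"

definition F :: "nat \<times> nat \<Rightarrow> (nat \<times> nat) set" where
  "F x = M x \<union> (if 0 < snd x then M (fst x, snd x - 1) else {})"

text \<open>Every gap of a group also carries the boundary of the enclosing gap, so that this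
  boundary stays connected along the whole chain.\<close>

definition gap_bag :: "nat \<times> nat \<Rightarrow> (nat \<times> nat) set" where
  "gap_bag x = F x \<union> (if 0 < fst x then F (region x) else {})"

lemma M_subset_F: "M x \<subseteq> F x" "M x \<subseteq> F (fst x, Suc (snd x))"
  by (auto simp: F_def)

lemma M_par_subset: "M (par x) \<subseteq> F (region x)"
  using M_subset_F by (auto simp: region_def)

lemma card_F: "finite (F x) \<and> card (F x) \<le> 4 * h + 2"
proof -
  have "card (F x) \<le> card (M x) + card (M (fst x, snd x - 1))" by (simp add: F_def card_Un_le)
  then show ?thesis using finite_M card_M[of x] card_M[of "(fst x, snd x - 1)"] by (simp add: F_def)
qed

lemma card_gap_bag: "card (gap_bag x) \<le> 8 * h + 4"
proof -
  have "card (gap_bag x) \<le> card (F x) + card (F (region x))" by (simp add: gap_bag_def card_Un_le)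
  then show ?thesis using card_F[of x] card_F[of "region x"] by simp
qed

section \<open>Moving between neighbouring gaps\<close>

lemma div_Suc:
  assumes "r < K"
  shows "Suc (K * v + r) div K = (if Suc r = K then Suc v else v)"
proof (cases "Suc r = K")
  case True
  have "K * Suc v = Suc (K * v + r)" by (simp flip: True)
  then have "Suc (K * v + r) div K = K * Suc v div K" by (rule arg_cong[OF sym])
  then show ?thesis using True K_pos by (metis nonzero_mult_div_cancel_left not_less_zero)
next
  case False
  then have "Suc r div K = 0" using assms by simp
  moreover have "Suc (K * v + r) div K = v + Suc r div K"
    using K_pos div_mult_self2[of K "Suc r" v] by (simp add: add.commute)
  ultimately show ?thesis using False by simp
qed

text \<open>Only the node \<open>(d, n)\<close> lies between the two gaps. Crossing it changes the
  enclosing gap exactly when it continues the orbit of its parent.\<close>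

lemma region_step:
  assumes "0 < d"
  shows "region (d, Suc n) = (if chained (d, n) then (d - 1, Suc (n div K)) else region (d, n))"
proof -
  define v r a where "v = n div K" and "r = n mod K" and "a = step (d - 1, v)"
  have n: "n = K * v + r" and r: "r < K" and nv: "n div K = v" using K_pos by (simp_all add: v_def r_def)
  have a: "a < K" by (simp add: a_def step)
  have nx: "nxt (d - 1, v) = (Suc (d - 1), K * v + a)" by (simp add: nxt_def a_def)
  have "r = a \<longleftrightarrow> K * v + a = n" "r \<le> a \<longleftrightarrow> n \<le> K * v + a" "r < a \<longleftrightarrow> Suc n \<le> K * v + a"
    using n by auto
  note cmp = this
  have "chained (d, n) \<longleftrightarrow> r = a"
    using assms nx by (auto simp: chained_def par_def nv cmp(1))
  moreover have "region (d, n) = (if r \<le> a then (d - 1, v) else (d - 1, Suc v))"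
    using nx by (simp add: region_def par_def nv cmp(2))
  moreover have "region (d, Suc n) = (if r < a then (d - 1, v) else (d - 1, Suc v))"
  \<comment> \<open>Past the last child of \<open>v\<close> the parent becomes \<open>Suc v\<close>,
    but the enclosing gap is unaffected: the gap to the right of \<open>v\<close> is the one to the
    left of \<open>Suc v\<close>.\<close>
  proof (cases "Suc r = K")
    case True
    have "Suc n div K = Suc v" using True div_Suc[OF r, of v] n by simp
    moreover have "Suc n = K * Suc v" using True n by (simp flip: True)
    moreover have "K * Suc v \<le> snd (nxt (d - 1, Suc v))" by (simp add: nxt_def)
    ultimately show ?thesis using True a by (auto simp: region_def par_def)
  next
    case False
    then have "Suc n div K = v" using div_Suc[OF r, of v] n by simp
    then show ?thesis using nx by (simp add: region_def par_def cmp(3))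
  qed
  ultimately show ?thesis using nv by auto
qed

text \<open>The depth drops by one and the index does not grow: \<open>region x\<close> lies to the
  right of \<open>par x\<close> only if \<open>snd x\<close> exceeds the index of a child of
  \<open>par x\<close>, which is at least \<open>snd x div K\<close>.\<close>

lemma region_rank: assumes "0 < fst x" shows "fst (region x) + snd (region x) < fst x + snd x"
proof -
  define q where "q = snd x div K"
  have p: "par x = (fst x - 1, q)" by (simp add: par_def q_def)
  have "q \<le> K * q" using K_pos by simp
  then have "q \<le> snd (nxt (par x))" by (simp add: nxt_def p trans_le_add1)
  moreover have "q \<le> snd x" by (simp add: q_def)
  ultimately show ?thesis using assms by (auto simp: region_def p)
qed

lemma gap_parent_rank:
  assumes "x \<noteq> (0, 0)"
  shows "fst (gap_parent x) + snd (gap_parent x) < fst x + snd x"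
proof (cases "0 < snd x \<and> \<not> chained (fst x, snd x - 1)")
  case True
  then show ?thesis by (simp add: gap_parent_def)
next
  case False
  then have "0 < fst x" using assms by (cases x) (auto simp: chained_def)
  then show ?thesis using False region_rank by (auto simp: gap_parent_def)
qed

lemma region_in_gap_bag_parent:
  assumes "0 < fst x" "y \<in> F (region x)"
  shows "y \<in> gap_bag (gap_parent x)"
proof (cases "0 < snd x \<and> \<not> chained (fst x, snd x - 1)")
  case True
  then have "region x = region (fst x, snd x - 1)" using region_step[OF assms(1), of "snd x - 1"] by simp
  then show ?thesis using True assms by (simp add: gap_parent_def gap_bag_def)
next
  case False
  then show ?thesis using assms by (auto simp: gap_parent_def gap_bag_def)
qed

text \<open>The possible exception \<open>c\<close> is the unchained node whose orbit contains
  \<open>y\<close>, unique by \<open>orbit_start_unique\<close>. The cases ask whether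
  \<open>y\<close> comes from the enclosing gap, the right boundary or the left boundary.\<close>

lemma gap_bag_top:
  "\<exists>c. \<forall>x. y \<in> gap_bag x \<longrightarrow> x = c \<or> (x \<noteq> (0, 0) \<and> y \<in> gap_bag (gap_parent x))"
proof -
  obtain c where c: "\<And>s. y \<in> orbit s \<Longrightarrow> \<not> chained s \<Longrightarrow> s = c"
    using orbit_start_unique by metis
  have "x = c \<or> (x \<noteq> (0, 0) \<and> y \<in> gap_bag (gap_parent x))" if y: "y \<in> gap_bag x" for x
  proof -
    consider "0 < fst x" "y \<in> F (region x)" | "y \<in> M x" "\<not> (0 < fst x \<and> y \<in> F (region x))"
      | "0 < snd x" "y \<in> M (fst x, snd x - 1)"
      using y by (auto simp: gap_bag_def F_def split: if_splits)
    then show ?thesis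
    proof cases
      case 1
      then show ?thesis using region_in_gap_bag_parent by auto
    next
      case 2
      then show ?thesis using M_parent[of y x] M_par_subset c by blast
    next
      case 3
      let ?u = "(fst x, snd x - 1)"
      \<comment> \<open>If \<open>?u\<close> is chained, \<open>x\<close> is the first gap of its
        group and its parent lies just right of \<open>par ?u\<close>. Otherwise the parent is the
        gap whose right boundary belongs to \<open>?u\<close>.\<close>
      have "y \<in> F (gap_parent x)"
      proof (cases "chained ?u")
        case True
        then have "0 < fst x" by (simp add: chained_def)
        then have "gap_parent x = (fst (par ?u), Suc (snd (par ?u)))"
          using True region_step[of "fst x" "snd x - 1"] 3(1)
          by (simp add: gap_parent_def par_def)
        then show ?thesis using M_chained[OF 3(2) True] M_subset_F(2)[of "par ?u"] by auto
      next
        case False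
        then show ?thesis using 3 M_subset_F(1)[of ?u] by (auto simp: gap_parent_def)
      qed
      then show ?thesis using 3(1) by (auto simp: gap_bag_def)
    qed
  qed
  then show ?thesis by blast
qed

lemma self_in_gap_bag: "x \<in> X \<Longrightarrow> x \<in> gap_bag x"
  using self_in_bag[of x] M_subset_F(1)[of x] by (auto simp: gap_bag_def M_def)

text \<open>A less deep neighbour of \<open>x\<close> is in the memory of \<open>x\<close>; a left
  neighbour in the layer lies on the left boundary of the gap \<open>x\<close>.\<close>

lemma W_in_gap_bag:
  assumes "x \<in> X" "y \<in> X" "W x y"
  obtains "x \<in> gap_bag x" "y \<in> gap_bag x" | "x \<in> gap_bag y" "y \<in> gap_bag y"
proof -
  have 1: "y \<in> gap_bag x" if "down x y" "y \<in> X" for x y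
    using that down_in_bag[of x y] M_subset_F(1)[of x] by (auto simp: gap_bag_def M_def)
  have 2: "y \<in> gap_bag x" if "fst x = fst y" "snd x = Suc (snd y)" "y \<in> X" for x y
    using that self_in_bag[of y] M_subset_F(2)[of y] by (cases x; cases y) (auto simp: gap_bag_def M_def)
  have "y \<in> gap_bag x \<or> x \<in> gap_bag y"
    using assms 1[of x y] 1[of y x] 2[of x y] 2[of y x] unfolding W_def by auto
  then show ?thesis using that self_in_gap_bag assms by blast
qed

section \<open>The decomposition over finitely many gaps\<close>

lemma W_graph_treewidth_le:
  assumes "finite X"
  shows "treewidth_le (W_graph X) (8 * h + 4)"
proof -
  define R where "R = Max ((\<lambda>x. fst x + snd x) ` X)"
  have R: "fst x + snd x \<le> R" if "x \<in> X" for x using assms that by (simp add: R_def)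
  \<comment> \<open>This finite set contains \<open>X\<close> and is closed under
    \<open>gap_parent\<close>, which decreases the sum.\<close>
  define N where "N = {x :: nat \<times> nat. fst x + snd x \<le> R}"
  have "N \<subseteq> {..R} \<times> {..R}" by (auto simp: N_def)
  then have "finite N" by (rule finite_subset) simp
  have gp: "gap_parent x \<in> N" if "x \<in> N" "x \<noteq> (0, 0)" for x
    using gap_parent_rank[OF that(2)] that(1) by (simp add: N_def)
  interpret rooted "prod_encode ` N" "prod_encode (0, 0)"
    "\<lambda>t. prod_encode (gap_parent (prod_decode t))" "\<lambda>t. fst (prod_decode t) + snd (prod_decode t)"
  proof
    show "finite (prod_encode ` N)" using \<open>finite N\<close> by simp
    show "prod_encode (0, 0) \<in> prod_encode ` N" by (simp add: N_def)
  next
    fix t assume "t \<in> prod_encode ` N" "t \<noteq> prod_encode (0, 0)"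
    then obtain x where x: "t = prod_encode x" "x \<in> N" "x \<noteq> (0, 0)" by auto
    show "prod_encode (gap_parent (prod_decode t)) \<in> prod_encode ` N" using gp x by simp
    show "fst (prod_decode (prod_encode (gap_parent (prod_decode t)))) +
      snd (prod_decode (prod_encode (gap_parent (prod_decode t)))) < fst (prod_decode t) + snd (prod_decode t)"
      using gap_parent_rank x by simp
  qed
  let ?B = "\<lambda>t. prod_encode ` (gap_bag (prod_decode t) \<inter> X)"
  show ?thesis
  proof (rule treewidth_le[of ?B])
    fix t
    have "finite (gap_bag (prod_decode t))" using card_F by (simp add: gap_bag_def)
    then have "card (gap_bag (prod_decode t) \<inter> X) \<le> 8 * h + 4"
      using card_gap_bag by (meson card_mono inf_le1 le_trans)
    then show "card (?B t) \<le> 8 * h + 4 + 1"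
      using card_image[OF inj_on_subset[OF inj_prod_encode subset_UNIV]] by (simp add: le_SucI)
  next
    fix v assume "v \<in> verts (W_graph X)"
    then obtain x where x: "v = prod_encode x" "x \<in> X" by auto
    then show "\<exists>t\<in>prod_encode ` N. v \<in> ?B t"
      using self_in_gap_bag[of x] R[of x] by (intro bexI[of _ v]) (auto simp: N_def)
    obtain c where c: "\<forall>z. x \<in> gap_bag z \<longrightarrow> z = c \<or> (z \<noteq> (0, 0) \<and> x \<in> gap_bag (gap_parent z))"
      using gap_bag_top by blast
    have *: "v \<in> ?B t \<longleftrightarrow> x \<in> gap_bag (prod_decode t)" for t using x by auto
    show "\<exists>c. \<forall>t\<in>prod_encode ` N. v \<in> ?B t \<longrightarrow>
      t = c \<or> t \<noteq> prod_encode (0, 0) \<and> v \<in> ?B (prod_encode (gap_parent (prod_decode t)))"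
      using c unfolding * by (intro exI[of _ "prod_encode c"]) auto
  next
    fix u v assume uv: "adj (W_graph X) u v"
    define x y where "x = prod_decode u" and "y = prod_decode v"
    have u: "u = prod_encode x" and v: "v = prod_encode y" by (simp_all add: x_def y_def)
    have xy: "x \<in> X" "y \<in> X" "W x y" using uv by (auto simp: u v adj_W_graph)
    then have "\<exists>z\<in>X. x \<in> gap_bag z \<and> y \<in> gap_bag z" using W_in_gap_bag by metis
    then obtain z where "z \<in> X" "x \<in> gap_bag z" "y \<in> gap_bag z" by blast
    then show "\<exists>t\<in>prod_encode ` N. u \<in> ?B t \<and> v \<in> ?B t"
      using xy R[of z] by (intro bexI[of _ "prod_encode z"]) (auto simp: u v N_def)
  qed auto
qed

end

section \<open>Choosing the alphabet and assembling the class\<close>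

lemma letters_exist:
  "\<exists>(K :: nat) sl ad. (\<forall>a<K. sl a < h) \<and> (\<forall>k<h. \<forall>A\<subseteq>{..<h}. \<exists>a<K. sl a = k \<and> ad a = A)"
  for h :: nat
proof -
  let ?P = "{..<h} \<times> Pow {..<h}"
  obtain g where g: "bij_betw g {0..<card ?P} ?P" using ex_bij_betw_nat_finite[of ?P] by auto
  have "fst (g a) < h" if "a < card ?P" for a
    using bij_betwE[OF g] that by (force simp: mem_Times_iff)
  moreover have "\<exists>a<card ?P. fst (g a) = k \<and> snd (g a) = A" if "k < h" "A \<subseteq> {..<h}" for k A
  proof -
    have "(k, A) \<in> g ` {0..<card ?P}" using g that by (simp add: bij_betw_def)
    then obtain a where "a < card ?P" "g a = (k, A)" by auto
    then show ?thesis by (intro exI[of _ a]) simp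
  qed
  ultimately show ?thesis
    by (intro exI[of _ "card ?P"] exI[of _ "fst \<circ> g"] exI[of _ "snd \<circ> g"]) auto
qed

theorem theorem1p1:
  fixes H :: "'b graph"
  assumes "finite_graph H"
  shows "\<exists>C :: nat graph set. (\<forall>G\<in>C. finite_graph G) \<and> hereditary C \<and> weakly_sparse C \<and>
           \<not> bounded_treewidth C \<and> bounded_treewidth {G \<in> C. H_free H G}"
proof -
  \<comment> \<open>The summand 2 secures \<open>2 \<le> h\<close>, as the touching layers use slots
    0 and 1.\<close>
  define h where "h = card (verts H) + 2"
  obtain K :: nat and sl ad where lt: "\<And>a. a < K \<Longrightarrow> sl a < h"
    and ex: "\<And>k A. k < h \<Longrightarrow> A \<subseteq> {..<h} \<Longrightarrow> \<exists>a<K. sl a = k \<and> ad a = A"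
    using letters_exist[of h] by metis
  interpret wheel h K sl ad using lt ex by unfold_locales (auto simp: h_def)
  obtain \<phi> where \<phi>: "bij_betw \<phi> (verts H) {0..<card (verts H)}"
    using ex_bij_betw_finite_nat assms by (auto simp: finite_graph_def)
  \<comment> \<open>\<open>H\<close> is relabelled by \<open>\<phi>\<close> and padded with two
    isolated vertices; a copy of the padded graph contains one of \<open>H\<close>.\<close>
  define E where "E i j \<longleftrightarrow> (\<exists>u\<in>verts H. \<exists>v\<in>verts H. \<phi> u = i \<and> \<phi> v = j \<and> adj H u v)" for i j
  let ?C = "{rel_graph (\<lambda>u v. W (prod_decode u) (prod_decode v)) S | S. finite S}"
  have C: "?C = {W_graph X | X. finite X}"
  proof -
    have "\<exists>X. S = prod_encode ` X \<and> finite X" if "finite S" for S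
      using that by (intro exI[of _ "prod_decode ` S"]) (simp add: image_image)
    then show ?thesis unfolding W_graph_def by blast
  qed
  have free: "treewidth_le (W_graph X) (8 * h + 4)" if fin: "finite X" and free: "H_free H (W_graph X)" for X
  proof -
    interpret wheel_sub h K sl ad X E
    proof
      show "E i j \<longleftrightarrow> E j i" for i j using adj_sym[of H] by (auto simp: E_def)
    next
      fix f assume inj: "inj_on f {..<h}" and sub: "f ` {..<h} \<subseteq> X"
      show "\<exists>i<h. \<exists>j<h. i \<noteq> j \<and> \<not> (W (f i) (f j) \<longleftrightarrow> E i j)"
      proof (rule ccontr)
        assume "\<not> ?thesis"
        then have eq: "W (f i) (f j) \<longleftrightarrow> E i j" if "i < h" "j < h" "i \<noteq> j" for i j using that by blast
        have \<phi>h: "\<phi> u < h" if "u \<in> verts H" for u using bij_betwE[OF \<phi>] that by (auto simp: h_def)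
        have \<phi>_inj: "\<phi> u = \<phi> v \<longleftrightarrow> u = v" if "u \<in> verts H" "v \<in> verts H" for u v
          using \<phi> that by (auto simp: bij_betw_def inj_on_def)
        have f\<phi>_inj: "f (\<phi> u) = f (\<phi> v) \<longleftrightarrow> u = v" if "u \<in> verts H" "v \<in> verts H" for u v
          using inj_on_eq_iff[OF inj] \<phi>h \<phi>_inj that by simp
        have "contains_induced H (W_graph X)" unfolding contains_induced_def
        proof (intro exI[of _ "\<lambda>u. prod_encode (f (\<phi> u))"] conjI ballI)
          show "inj_on (\<lambda>u. prod_encode (f (\<phi> u))) (verts H)" using f\<phi>_inj by (auto intro: inj_onI)
          show "(\<lambda>u. prod_encode (f (\<phi> u))) ` verts H \<subseteq> verts (W_graph X)" using sub \<phi>h by auto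
          fix u v assume uv: "u \<in> verts H" "v \<in> verts H"
          have E: "E (\<phi> u) (\<phi> v) \<longleftrightarrow> adj H u v" using uv \<phi>_inj by (auto simp: E_def)
          have X: "f (\<phi> u) \<in> X" "f (\<phi> v) \<in> X" using uv \<phi>h sub by auto
          show "adj H u v \<longleftrightarrow> adj (W_graph X) (prod_encode (f (\<phi> u))) (prod_encode (f (\<phi> v)))"
          proof (cases "u = v")
            case True
            then show ?thesis by (simp add: adj_def)
          next
            case False
            then show ?thesis using E X eq[of "\<phi> u" "\<phi> v"] \<phi>h \<phi>_inj uv by (simp add: adj_W_graph)
          qed
        qed
        then show False using free by (simp add: H_free_def)
      qed
    qed
    show ?thesis using W_graph_treewidth_le fin .
  qed
  show ?thesis
  proof (intro exI[of _ ?C] conjI)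
    show "\<forall>G\<in>?C. finite_graph G" using finite_rel_graph by blast
    show "hereditary ?C" by (rule hereditary_rel_graphs)
    show "weakly_sparse ?C" unfolding C weakly_sparse_def using W_graph_no_Ktt by blast
    show "\<not> bounded_treewidth ?C" unfolding C bounded_treewidth_def using W_graph_large_treewidth by blast
    show "bounded_treewidth {G \<in> ?C. H_free H G}" unfolding C bounded_treewidth_def using free by blast
  qed
qed

end
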